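(* Let $\Omega\subseteq\mathbb{R}^n$ be a connected open set, let $\sigma\in\mathcal{M}^+(\Omega)$, and let $0<q<1$. Let $G:\Omega\times\Omega\to[0,+\infty]$ be a lower semicontinuous kernel which is quasi-symmetric and satisfies the weak maximum principle. Then the following statements are equivalent: (1) There exists a positive constant $\varkappa_w$ such that $\|\mathbf{G}\nu\|_{L^{q,\infty}(\sigma)}\le\varkappa_w\|\nu\|$ for all $\nu\in\mathcal{M}^+(\Omega)$. (2) There exists a positive constant $c$ such that $\sigma(K)\le c\,\big(\operatorname{cap}(K)\big)^q$ for all compact sets $K\subset\Omega$. (3) $\mathbf{G}\sigma\in L^{\frac{q}{1-q},\infty}(\sigma)$.
   Context: $\mathcal{M}^+(\Omega)$ is the class of all nonnegative locally finite Borel measures on $\Omega$; $\|\nu\|=\nu(\Omega)$; $S(\nu)$ is the support of $\nu$; $\mathbf{G}\nu(x)=\int_\Omega G(x,y)\,d\nu(y)$. Quasi-symmetric: there is a constant $a>0$ with $a^{-1}G(x,y)\le G(y,x)\le a\,G(x,y)$ for all $x,y\in\Omega$. Weak maximum principle: there is a constant $h\ge1$ such that for every $\nu\in\mathcal{M}^+(\Omega)$ and every constant $M>0$, if $\mathbf{G}\nu(x)\le M$ for all $x\in S(\nu)$ then $\mathbf{G}\nu(x)\le hM$ for all $x\in\Omega$. For $0<r<\infty$, $\|f\|_{L^{r,\infty}(\sigma)}=\sup_{t>0}t\,\sigma(\{x:|f(x)|>t\})^{1/r}$, and $L^{r,\infty}(\sigma)$ consists of the $f$ for which this is finite. $\operatorname{cap}(K)$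 is the (inner) capacity of the compact set $K$ associated with the kernel $G$: $\operatorname{cap}(K)=\sup\{\lambda(K):\lambda \text{ a nonnegative finite Borel measure supported in } K,\ \mathbf{G}\lambda\le1 \text{ on } S(\lambda)\}\in[0,+\infty]$. *)

theory Defs
  imports "HOL-Analysis.Analysis"
begin

definition loc_finite_measures :: "'a::topological_space set \<Rightarrow> 'a measure set" where
  "loc_finite_measures \<Omega> =
     {\<nu>. sets \<nu> = sets (restrict_space borel \<Omega>) \<and>
         (\<forall>x\<in>\<Omega>. \<exists>U. open U \<and> x \<in> U \<and> emeasure \<nu> (U \<inter> \<Omega>) < \<infinity>)}"

text \<open>The support is taken relative to the space of the measure; for a Borel measure on
  \<open>\<Omega>\<close> that space is \<open>\<Omega>\<close>, so the support is a relatively closed subset of \<open>\<Omega>\<close>.\<close>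

definition measure_support :: "'a::topological_space measure \<Rightarrow> 'a set" where
  "measure_support \<nu> =
     {x \<in> space \<nu>. \<forall>U. open U \<longrightarrow> x \<in> U \<longrightarrow> 0 < emeasure \<nu> (U \<inter> space \<nu>)}"

definition potential :: "('a \<Rightarrow> 'a \<Rightarrow> ennreal) \<Rightarrow> 'a measure \<Rightarrow> 'a \<Rightarrow> ennreal" where
  "potential G \<nu> x = (\<integral>\<^sup>+ y. G x y \<partial>\<nu>)"

definition lower_semicontinuous_on ::
    "'a::topological_space set \<Rightarrow> ('a \<Rightarrow> 'b::linorder) \<Rightarrow> bool" where
  "lower_semicontinuous_on S f \<longleftrightarrow> (\<forall>t. openin (top_of_set S) {x \<in> S. t < f x})"

definition quasi_symmetric :: "'a set \<Rightarrow> ('a \<Rightarrow> 'a \<Rightarrow> ennreal) \<Rightarrow> bool" where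
  "quasi_symmetric \<Omega> G \<longleftrightarrow>
     (\<exists>a::real. a > 0 \<and> (\<forall>x\<in>\<Omega>. \<forall>y\<in>\<Omega>.
        ennreal (inverse a) * G x y \<le> G y x \<and> G y x \<le> ennreal a * G x y))"

definition weak_maximum_principle ::
    "'a::topological_space set \<Rightarrow> ('a \<Rightarrow> 'a \<Rightarrow> ennreal) \<Rightarrow> bool" where
  "weak_maximum_principle \<Omega> G \<longleftrightarrow>
     (\<exists>h::real. h \<ge> 1 \<and> (\<forall>\<nu>\<in>loc_finite_measures \<Omega>. \<forall>M::real. M > 0 \<longrightarrow>
        (\<forall>x\<in>measure_support \<nu>. potential G \<nu> x \<le> ennreal M) \<longrightarrow>
        (\<forall>x\<in>\<Omega>. potential G \<nu> x \<le> ennreal (h * M))))"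

text \<open>Only used with a positive exponent, where the power of \<open>\<infinity>\<close> is \<open>\<infinity>\<close>.\<close>

definition ennreal_powr :: "ennreal \<Rightarrow> real \<Rightarrow> ennreal" where
  "ennreal_powr x p = (if x = \<infinity> then \<infinity> else ennreal (enn2real x powr p))"

text \<open>The functions considered are \<open>[0, \<infinity>]\<close>-valued, so no absolute value is needed.\<close>

definition weak_L_norm :: "'a measure \<Rightarrow> real \<Rightarrow> ('a \<Rightarrow> ennreal) \<Rightarrow> ennreal" where
  "weak_L_norm \<sigma> r f =
     (SUP t\<in>{0::real<..}. ennreal t * ennreal_powr (emeasure \<sigma> {x \<in> space \<sigma>. ennreal t < f x}) (1 / r))"

definition weak_L_space :: "'a measure \<Rightarrow> real \<Rightarrow> ('a \<Rightarrow> ennreal) set" where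
  "weak_L_space \<sigma> r = {f \<in> borel_measurable \<sigma>. weak_L_norm \<sigma> r f < \<infinity>}"

definition inner_capacity ::
    "'a::topological_space set \<Rightarrow> ('a \<Rightarrow> 'a \<Rightarrow> ennreal) \<Rightarrow> 'a set \<Rightarrow> ennreal" where
  "inner_capacity \<Omega> G K =
     (SUP \<mu>\<in>{\<mu>. sets \<mu> = sets (restrict_space borel \<Omega>) \<and> finite_measure \<mu> \<and>
                measure_support \<mu> \<subseteq> K \<and> (\<forall>x\<in>measure_support \<mu>. potential G \<mu> x \<le> 1)}.
        emeasure \<mu> K)"

end

theory Submission
  imports Defs
begin

text \<open>Lower semicontinuity makes the sublevel sets of a potential relatively closed. If \<open>G\<sigma>\<^sub>K \<le> t\<close>
  on at least half of \<open>K\<close> (in \<open>\<sigma>\<close>-measure), then \<open>\<sigma>\<close> restricted to that part and divided by \<open>t\<close>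
  is admissible, so \<open>\<sigma>(K) \<le> 2 t cap(K)\<close>. Each of the weak-type bounds (1), applied to \<open>\<sigma>\<^sub>K\<close>, and (3)
  provides such a \<open>t\<close> of order \<open>\<sigma>(K)\<close> to the power \<open>1 - 1/q\<close>, which is (2).

  Conversely, let \<open>\<lambda>\<close> be admissible for a compact \<open>K \<subseteq> {G\<nu> > t}\<close>, so that \<open>G\<lambda> \<le> h\<close> everywhere by
  the weak maximum principle. Quasi-symmetry gives \<open>t \<parallel>\<lambda>\<parallel> \<le> a \<integral>G\<lambda> d\<nu>\<close>. Bounding the right side by
  \<open>a h \<parallel>\<nu>\<parallel>\<close> yields (1) from (2). For \<open>\<nu> = \<sigma>\<close>, integrating the weak-type bound (1) for \<open>G\<lambda>\<close> up to the
  height \<open>h\<close> bounds it by a multiple of \<open>\<parallel>\<lambda>\<parallel>\<close> to the power \<open>q < 1\<close>, whence a bound on \<open>cap(K)\<close> and (3).\<close>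

section \<open>Borel measures on \<Omega> and lower semicontinuity of potentials\<close>

locale lsc_kernel =
  fixes \<Omega> :: "'a::euclidean_space set" and G :: "'a \<Rightarrow> 'a \<Rightarrow> ennreal"
  assumes open_\<Omega>: "open \<Omega>"
    and lsc: "lower_semicontinuous_on (\<Omega> \<times> \<Omega>) (\<lambda>(x, y). G x y)"
begin

abbreviation borel_on :: "'a measure \<Rightarrow> bool" where
  "borel_on \<nu> \<equiv> sets \<nu> = sets (restrict_space borel \<Omega>)"

lemma space_borel_on: "borel_on \<nu> \<Longrightarrow> space \<nu> = \<Omega>"
  using sets_eq_imp_space_eq[of \<nu> "restrict_space borel \<Omega>"] by (simp add: space_restrict_space)

lemma sets_borel_on: "borel_on \<nu> \<Longrightarrow> A \<in> sets \<nu> \<longleftrightarrow> A \<subseteq> \<Omega> \<and> A \<in> sets borel"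
  using open_\<Omega> by (simp add: sets_restrict_space_iff)

lemma open_in_sets: "borel_on \<nu> \<Longrightarrow> open A \<Longrightarrow> A \<subseteq> \<Omega> \<Longrightarrow> A \<in> sets \<nu>"
  by (simp add: sets_borel_on)

lemma compact_in_sets: "borel_on \<nu> \<Longrightarrow> compact A \<Longrightarrow> A \<subseteq> \<Omega> \<Longrightarrow> A \<in> sets \<nu>"
  by (simp add: sets_borel_on borel_compact)

lemma loc_finite_borel_on: "\<nu> \<in> loc_finite_measures \<Omega> \<Longrightarrow> borel_on \<nu>"
  by (simp add: loc_finite_measures_def)

lemma finite_loc_finite:
  assumes "borel_on \<nu>" "finite_measure \<nu>"
  shows "\<nu> \<in> loc_finite_measures \<Omega>"
proof -
  have "\<exists>U. open U \<and> x \<in> U \<and> emeasure \<nu> (U \<inter> \<Omega>) < \<infinity>" for x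
    using finite_measure.emeasure_finite[OF assms(2)]
    by (intro exI[of _ UNIV]) (auto simp: top.not_eq_extremum)
  then show ?thesis
    using assms(1) by (auto simp: loc_finite_measures_def)
qed

lemma compact_finite_measure:
  assumes \<nu>: "\<nu> \<in> loc_finite_measures \<Omega>" and K: "compact K" "K \<subseteq> \<Omega>"
  shows "emeasure \<nu> K < \<infinity>"
proof -
  note b = loc_finite_borel_on[OF \<nu>]
  have "\<forall>x\<in>\<Omega>. \<exists>U. open U \<and> x \<in> U \<and> emeasure \<nu> (U \<inter> \<Omega>) < \<infinity>"
    using \<nu> by (simp add: loc_finite_measures_def)
  then obtain U where U: "\<And>x. x \<in> \<Omega> \<Longrightarrow> open (U x) \<and> x \<in> U x \<and> emeasure \<nu> (U x \<inter> \<Omega>) < \<infinity>"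
    by metis
  obtain C where C: "C \<subseteq> K" "finite C" "K \<subseteq> (\<Union>x\<in>C. U x)"
    using compactE_image[OF K(1), of K U] U K(2) by blast
  have m: "U x \<inter> \<Omega> \<in> sets \<nu>" if "x \<in> C" for x
    using C(1) K(2) U that open_\<Omega> by (intro open_in_sets[OF b]) auto
  have "emeasure \<nu> K \<le> emeasure \<nu> (\<Union>x\<in>C. U x \<inter> \<Omega>)"
    using C K m by (intro emeasure_mono sets.finite_UN) auto
  also have "\<dots> \<le> (\<Sum>x\<in>C. emeasure \<nu> (U x \<inter> \<Omega>))"
    using m C(2) by (intro emeasure_subadditive_finite) auto
  also have "\<dots> < \<infinity>"
    using U C K(2) by (auto simp: subset_iff)
  finally show ?thesis .
qed

text \<open>Makes Tonelli's theorem available in \<open>potential_duality\<close>. The open set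
  \<Omega> is a countable union of compact sets, and a locally finite measure is finite on each of
  them.\<close>

lemma loc_finite_sigma_finite:
  assumes \<nu>: "\<nu> \<in> loc_finite_measures \<Omega>"
  shows "sigma_finite_measure \<nu>"
proof -
  obtain C :: "nat \<Rightarrow> 'a set" where C: "\<And>n. compact (C n)" "\<And>n. C n \<subseteq> \<Omega>" "\<Union>(range C) = \<Omega>"
    by (rule open_Union_compact_subsets[OF open_\<Omega>], rule that)
  note b = loc_finite_borel_on[OF \<nu>]
  show ?thesis
    by (rule sigma_finite_measure.intro, rule exI[of _ "range C"])
      (use C compact_in_sets[OF b] compact_finite_measure[OF \<nu>] space_borel_on[OF b] in \<open>auto simp: less_top\<close>)
qed

text \<open>Continuity from below along a compact exhaustion of \<open>E\<close> takes the place of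
  inner regularity. Capacity estimates concern compact sets; this carries them over to the open
  superlevel sets of potentials.\<close>

lemma emeasure_open_le:
  assumes b: "borel_on \<nu>" and E: "open E" "E \<subseteq> \<Omega>"
    and le: "\<And>K. compact K \<Longrightarrow> K \<subseteq> E \<Longrightarrow> emeasure \<nu> K \<le> B"
  shows "emeasure \<nu> E \<le> B"
proof -
  obtain C :: "nat \<Rightarrow> 'a set" where C: "\<And>n. compact (C n)" "\<And>n. C n \<subseteq> E" "\<And>n. C n \<subseteq> interior (C (Suc n))"
      "\<Union>(range C) = E"
    by (rule open_Union_compact_subsets[OF E(1)], rule that)
  have "incseq C"
    using C(3) interior_subset by (intro incseq_SucI) blast
  moreover have "range C \<subseteq> sets \<nu>"
    using C(1,2) E(2) compact_in_sets[OF b] by blast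
  ultimately have "(SUP n. emeasure \<nu> (C n)) = emeasure \<nu> E"
    using SUP_emeasure_incseq[of C \<nu>] C(4) by simp
  moreover have "(SUP n. emeasure \<nu> (C n)) \<le> B"
    by (rule SUP_least) (rule le[OF C(1,2)])
  ultimately show ?thesis by simp
qed

lemma open_superlevel: "open {p \<in> \<Omega> \<times> \<Omega>. t < case_prod G p}"
proof -
  have "openin (top_of_set (\<Omega> \<times> \<Omega>)) {p \<in> \<Omega> \<times> \<Omega>. t < case_prod G p}"
    using lsc by (simp add: lower_semicontinuous_on_def)
  then show ?thesis
    using openin_open_eq[OF open_Times[OF open_\<Omega> open_\<Omega>]] by blast
qed

lemma kernel_measurable:
  assumes "borel_on \<mu>" "borel_on \<nu>"
  shows "case_prod G \<in> borel_measurable (\<mu> \<Otimes>\<^sub>M \<nu>)"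
proof -
  have id: "(\<lambda>x. x) \<in> borel_measurable \<eta>" if "borel_on \<eta>" for \<eta>
    using measurable_ident by (subst measurable_cong_sets[OF that refl]) (simp add: measurable_restrict_space1 id_def)
  have "(\<lambda>p. (fst p, snd p)) \<in> (\<mu> \<Otimes>\<^sub>M \<nu>) \<rightarrow>\<^sub>M (borel \<Otimes>\<^sub>M borel)"
    using measurable_compose[OF measurable_fst id[OF assms(1)]]
      measurable_compose[OF measurable_snd id[OF assms(2)]] by (intro measurable_Pair) auto
  \<comment> \<open>By second countability the product of the Borel sigma-algebras is the Borel
    sigma-algebra of the product space, so open sets of pairs are measurable.\<close>
  then have m: "(\<lambda>p. p) \<in> (\<mu> \<Otimes>\<^sub>M \<nu>) \<rightarrow>\<^sub>M borel"
    by (simp add: borel_prod)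
  show ?thesis
  proof (rule borel_measurableI_greater)
    fix t
    have "{p \<in> space (\<mu> \<Otimes>\<^sub>M \<nu>). t < case_prod G p} = (\<lambda>p. p) -` {p \<in> \<Omega> \<times> \<Omega>. t < case_prod G p} \<inter> space (\<mu> \<Otimes>\<^sub>M \<nu>)"
      by (auto simp: space_pair_measure space_borel_on assms)
    also have "\<dots> \<in> sets (\<mu> \<Otimes>\<^sub>M \<nu>)"
      by (rule measurable_sets[OF m]) (simp add: open_superlevel)
    finally show "{p \<in> space (\<mu> \<Otimes>\<^sub>M \<nu>). t < case_prod G p} \<in> sets (\<mu> \<Otimes>\<^sub>M \<nu>)" .
  qed
qed

lemma kernel_section_measurable:
  assumes "borel_on \<nu>" "x \<in> \<Omega>"
  shows "G x \<in> borel_measurable \<nu>"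
  using measurable_Pair2[OF kernel_measurable[OF assms(1,1)]] assms(2) space_borel_on[OF assms(1)] by simp

text \<open>Fatou's lemma along the sequence: for each fixed \<open>y\<close>, lower semicontinuity
  of \<open>G\<close> at the point \<open>(l, y)\<close> gives the inequality between the
  integrands.\<close>

lemma potential_le_liminf:
  assumes b: "borel_on \<nu>" and X: "\<And>n. X n \<in> \<Omega>" "X \<longlonglongrightarrow> l" and l: "l \<in> \<Omega>"
  shows "potential G \<nu> l \<le> liminf (\<lambda>n. potential G \<nu> (X n))"
proof -
  have "G l y \<le> liminf (\<lambda>n. G (X n) y)" if y: "y \<in> \<Omega>" for y
    unfolding le_Liminf_iff
  proof (intro allI impI)
    fix t assume "t < G l y"
    then have "(l, y) \<in> {p \<in> \<Omega> \<times> \<Omega>. t < case_prod G p}"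
      using l y by simp
    moreover have "(\<lambda>n. (X n, y)) \<longlonglongrightarrow> (l, y)"
      using X(2) by (intro tendsto_intros)
    ultimately have "\<forall>\<^sub>F n in sequentially. (X n, y) \<in> {p \<in> \<Omega> \<times> \<Omega>. t < case_prod G p}"
      using topological_tendstoD[OF _ open_superlevel] by blast
    then show "\<forall>\<^sub>F n in sequentially. t < G (X n) y"
      by eventually_elim simp
  qed
  then have "potential G \<nu> l \<le> (\<integral>\<^sup>+ y. liminf (\<lambda>n. G (X n) y) \<partial>\<nu>)"
    unfolding potential_def by (intro nn_integral_mono) (simp add: space_borel_on[OF b])
  also have "\<dots> \<le> liminf (\<lambda>n. potential G \<nu> (X n))"
    unfolding potential_def
    by (intro nn_integral_liminf) (auto intro: kernel_section_measurable[OF b] X)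
  finally show ?thesis .
qed

text \<open>Potentials inherit lower semicontinuity from the kernel. Fatou's lemma works with
  sequences, so the complement is shown to be sequentially closed, which suffices in a Euclidean
  space.\<close>

lemma open_potential_superlevel:
  assumes b: "borel_on \<nu>"
  shows "open {x \<in> \<Omega>. t < potential G \<nu> x}" (is "open ?S")
proof -
  have "l \<notin> ?S" if X: "\<And>n. X n \<notin> ?S" "X \<longlonglongrightarrow> l" for X l
  proof
    assume l: "l \<in> ?S"
    have ev: "\<forall>\<^sub>F n in sequentially. X n \<in> \<Omega>"
      using topological_tendstoD[OF X(2) open_\<Omega>] l by simp
    \<comment> \<open>\<open>potential_le_liminf\<close> wants every term in \<Omega>. The finitely
      many terms outside are replaced by the limit, which does not affect the liminf.\<close>
    define Y where "Y n = (if X n \<in> \<Omega> then X n else l)" for n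
    have Y_in: "Y n \<in> \<Omega>" for n
      using l by (simp add: Y_def)
    have "\<forall>\<^sub>F n in sequentially. X n = Y n"
      using ev by eventually_elim (simp add: Y_def)
    with X(2) have "Y \<longlonglongrightarrow> l"
      by (rule Lim_transform_eventually)
    then have "potential G \<nu> l \<le> liminf (\<lambda>n. potential G \<nu> (Y n))"
      using l by (intro potential_le_liminf[OF b]) (auto simp: Y_in)
    then have "\<forall>\<^sub>F n in sequentially. t < potential G \<nu> (Y n)"
      using l unfolding le_Liminf_iff by auto
    with ev have "\<forall>\<^sub>F n in sequentially. X n \<in> ?S"
      by eventually_elim (simp add: Y_def)
    then have "\<exists>n. X n \<in> ?S"
      using eventually_happens sequentially_bot by blast
    then show False
      using X(1) by blast
  qed
  then have "closed (- ?S)"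
    unfolding closed_sequential_limits by blast
  then show ?thesis
    by (simp add: open_closed)
qed

lemma potential_measurable:
  assumes "borel_on \<nu>" "borel_on \<mu>"
  shows "potential G \<nu> \<in> borel_measurable \<mu>"
  by (rule borel_measurableI_greater)
    (auto simp: space_borel_on[OF assms(2)] intro!: open_in_sets[OF assms(2)] open_potential_superlevel[OF assms(1)])

section \<open>Sublevel sets of potentials and capacity\<close>

lemma inner_capacity_upper:
  assumes "borel_on \<mu>" "finite_measure \<mu>" "measure_support \<mu> \<subseteq> K"
    "\<And>x. x \<in> measure_support \<mu> \<Longrightarrow> potential G \<mu> x \<le> 1"
  shows "emeasure \<mu> K \<le> inner_capacity \<Omega> G K"
  unfolding inner_capacity_def using assms by (intro SUP_upper) auto

text \<open>The sublevel set \<open>F\<close> is \<open>K\<close> minus an open set, hence compact.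
  Therefore the support of \<open>\<mu>\<close>, the restriction of \<sigma> to \<open>F\<close>
  divided by \<open>t\<close>, stays inside \<open>F\<close>, and the constraint on its potential
  only has to be checked where the potential of \<open>\<sigma>K\<close> is at most
  \<open>t\<close>.\<close>

lemma sublevel_le_inner_capacity:
  assumes \<sigma>: "\<sigma> \<in> loc_finite_measures \<Omega>" and K: "compact K" "K \<subseteq> \<Omega>" and t: "0 < t"
  shows "emeasure \<sigma> {x \<in> K. potential G (density \<sigma> (indicator K)) x \<le> ennreal t}
    \<le> ennreal t * inner_capacity \<Omega> G K"
proof -
  note b = loc_finite_borel_on[OF \<sigma>]
  define \<sigma>K where "\<sigma>K = density \<sigma> (indicator K)"
  define F where "F = {x \<in> K. potential G \<sigma>K x \<le> ennreal t}"
  have bK: "borel_on \<sigma>K"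
    using b by (simp add: \<sigma>K_def)
  have "F = K - {x \<in> \<Omega>. ennreal t < potential G \<sigma>K x}"
    using K(2) by (auto simp: F_def)
  then have F: "compact F" "F \<subseteq> K" "F \<subseteq> \<Omega>"
    using compact_diff[OF K(1) open_potential_superlevel[OF bK]] K(2) by auto
  note mF[measurable] = compact_in_sets[OF b F(1,3)]
  note mK[measurable] = compact_in_sets[OF b K]
  define \<mu> where "\<mu> = density \<sigma> (\<lambda>x. ennreal (1/t) * indicator F x)"
  have b\<mu>: "borel_on \<mu>"
    using b by (simp add: \<mu>_def)
  have em: "emeasure \<mu> A = ennreal (1/t) * emeasure \<sigma> (F \<inter> A)" if [measurable]: "A \<in> sets \<sigma>" for A
  proof -
    have "emeasure \<mu> A = (\<integral>\<^sup>+x. ennreal (1/t) * indicator (F \<inter> A) x \<partial>\<sigma>)"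
      unfolding \<mu>_def by (subst emeasure_density) (auto intro!: nn_integral_cong simp: indicator_def)
    then show ?thesis
      by (simp add: nn_integral_cmult)
  qed
  have finF: "emeasure \<sigma> F < \<infinity>"
    using compact_finite_measure[OF \<sigma> F(1,3)] .
  have fin: "finite_measure \<mu>"
  proof (rule finite_measureI)
    have "emeasure \<mu> (space \<mu>) = ennreal (1/t) * emeasure \<sigma> F"
      using em[of \<Omega>] sets.top[of \<sigma>] F(3) by (simp add: space_borel_on[OF b] space_borel_on[OF b\<mu>] Int_absorb2)
    then show "emeasure \<mu> (space \<mu>) \<noteq> \<infinity>"
      using finF by (auto simp: ennreal_mult_eq_top_iff)
  qed
  have supp: "measure_support \<mu> \<subseteq> F"
  proof
    fix x assume x: "x \<in> measure_support \<mu>"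
    show "x \<in> F"
    proof (rule ccontr)
      assume "x \<notin> F"
      \<comment> \<open>The complement of the closed set \<open>F\<close> is a neighbourhood of
        \<open>x\<close>, and \<mu> does not charge it.\<close>
      then have "0 < emeasure \<mu> (- F \<inter> \<Omega>)"
        using x compact_imp_closed[OF F(1)] unfolding measure_support_def
        by (auto simp: space_borel_on[OF b\<mu>] open_Compl)
      moreover have "- F \<inter> \<Omega> \<in> sets \<sigma>"
        using compact_imp_closed[OF F(1)] open_\<Omega> by (intro open_in_sets[OF b]) auto
      ultimately show False
        by (simp add: em)
    qed
  qed
  have pot: "potential G \<mu> x \<le> 1" if x: "x \<in> F" for x
  proof -
    have [measurable]: "G x \<in> borel_measurable \<sigma>"
      using kernel_section_measurable[OF b] x F(3) by blast
    have "potential G \<mu> x = (\<integral>\<^sup>+y. ennreal (1/t) * (indicator F y * G x y) \<partial>\<sigma>)"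
      unfolding potential_def \<mu>_def by (subst nn_integral_density) (auto simp: mult.assoc)
    also have "\<dots> = ennreal (1/t) * (\<integral>\<^sup>+y. indicator F y * G x y \<partial>\<sigma>)"
      by (rule nn_integral_cmult) measurable
    also have "\<dots> \<le> ennreal (1/t) * (\<integral>\<^sup>+y. indicator K y * G x y \<partial>\<sigma>)"
      using F(2) by (intro mult_left_mono nn_integral_mono) (auto simp: indicator_def)
    also have "\<dots> = ennreal (1/t) * potential G \<sigma>K x"
      unfolding potential_def \<sigma>K_def by (subst nn_integral_density) auto
    also have "\<dots> \<le> ennreal (1/t) * ennreal t"
      using x by (intro mult_left_mono) (auto simp: F_def)
    also have "\<dots> = 1"
      using t by (simp flip: ennreal_mult)
    finally show ?thesis .
  qed
  have "emeasure \<sigma> F = ennreal t * (ennreal (1/t) * emeasure \<sigma> F)"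
    using t by (simp flip: mult.assoc ennreal_mult)
  also have "\<dots> = ennreal t * emeasure \<mu> K"
    using F(2) by (simp add: em Int_absorb2)
  also have "\<dots> \<le> ennreal t * inner_capacity \<Omega> G K"
    using supp F(2) pot by (intro mult_left_mono inner_capacity_upper[OF b\<mu> fin]) auto
  finally show ?thesis
    by (simp add: F_def \<sigma>K_def)
qed

end

section \<open>Weak Lebesgue norms and a dyadic integral estimate\<close>

lemma ennreal_powr_ennreal: "0 \<le> x \<Longrightarrow> ennreal_powr (ennreal x) p = ennreal (x powr p)"
  by (simp add: ennreal_powr_def)

lemma ennreal_powr_mono: "0 \<le> p \<Longrightarrow> x \<le> y \<Longrightarrow> ennreal_powr x p \<le> ennreal_powr y p"
  by (cases x; cases y) (auto simp: ennreal_powr_def powr_mono2 top_unique)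

text \<open>Weak-type bounds are used below as bounds on the distribution function: each term of the
  supremum is solved for the measure by raising to the power \<open>r\<close>. A superlevel set of
  infinite measure violates both sides.\<close>

lemma weak_L_norm_le_iff:
  assumes r: "0 < r" and B: "0 \<le> B"
  shows "weak_L_norm \<sigma> r f \<le> ennreal B \<longleftrightarrow>
    (\<forall>t>0. emeasure \<sigma> {x \<in> space \<sigma>. ennreal t < f x} \<le> ennreal ((B / t) powr r))"
proof -
  have "ennreal t * ennreal_powr e (1 / r) \<le> ennreal B \<longleftrightarrow> e \<le> ennreal ((B / t) powr r)"
    if t: "0 < t" for t e
  proof (cases e)
    case (real x)
    have "ennreal t * ennreal_powr e (1 / r) \<le> ennreal B \<longleftrightarrow> x powr (1 / r) \<le> B / t"
      using real t B by (simp add: ennreal_powr_ennreal field_simps flip: ennreal_mult)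
    also have "\<dots> \<longleftrightarrow> x \<le> (B / t) powr r"
    proof
      assume "x powr (1 / r) \<le> B / t"
      then have "(x powr (1 / r)) powr r \<le> (B / t) powr r"
        using r by (intro powr_mono2) auto
      then show "x \<le> (B / t) powr r"
        using r real by (simp add: powr_powr)
    next
      assume "x \<le> (B / t) powr r"
      then have "x powr (1 / r) \<le> ((B / t) powr r) powr (1 / r)"
        using r real by (intro powr_mono2) auto
      then show "x powr (1 / r) \<le> B / t"
        using r B t by (simp add: powr_powr)
    qed
    finally show ?thesis
      using real by simp
  next
    case top
    then show ?thesis
      using t by (simp add: ennreal_powr_def ennreal_mult_top top_unique)
  qed
  then show ?thesis
    unfolding weak_L_norm_def SUP_le_iff Ball_def greaterThan_iff by blast
qed

text \<open>Dyadic layer cake: a positive \<open>y\<close> lies in one of the intervals from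
  \<open>h / 2 ^ Suc k\<close> to \<open>h / 2 ^ k\<close>, and the term of that index alone already
  dominates it.\<close>

lemma ennreal_le_dyadic_suminf:
  fixes h :: real and y :: ennreal
  assumes h: "0 < h" and y: "y \<le> ennreal h"
  shows "y \<le> (\<Sum>k. ennreal (h / 2 ^ k) * indicator {ennreal (h / 2 ^ Suc k)<..} y)"
proof (cases "y = 0")
  case False
  with y h obtain z where z: "y = ennreal z" "0 < z" "z \<le> h"
    by (cases y) (auto simp: top_unique)
  obtain n where "h / z < 2 ^ n"
    using real_arch_pow[of 2 "h / z"] by auto
  then have "h / 2 ^ Suc n < z"
    using z h by (simp add: field_simps)
  \<comment> \<open>Minimality gives the upper bound \<open>z \<le> h / 2 ^ k\<close> from the
    failure at the preceding index; for \<open>k = 0\<close> it is the assumed ceiling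
    \<open>h\<close>.\<close>
  define k where "k = (LEAST k. h / 2 ^ Suc k < z)"
  have k: "h / 2 ^ Suc k < z"
    unfolding k_def by (rule LeastI) fact
  have "z \<le> h / 2 ^ k"
  proof (cases k)
    case (Suc j)
    then have "\<not> h / 2 ^ Suc j < z"
      unfolding k_def by (intro not_less_Least) auto
    with Suc show ?thesis by simp
  qed (use z in simp)
  then have "y \<le> ennreal (h / 2 ^ k) * indicator {ennreal (h / 2 ^ Suc k)<..} y"
    using k z h by (simp add: ennreal_leI ennreal_less_iff)
  also have "\<dots> \<le> (\<Sum>k. ennreal (h / 2 ^ k) * indicator {ennreal (h / 2 ^ Suc k)<..} y)"
    using sum_le_suminf[of g "{k}" for g :: "nat \<Rightarrow> ennreal", OF summableI] by (simp del: power_Suc)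
  finally show ?thesis .
qed simp

text \<open>Layer \<open>k\<close> has height \<open>h / 2 ^ k\<close> and measure at most a
  multiple of \<open>2 powr (k * q)\<close>, so the layers are summed by a geometric series of ratio
  \<open>2 powr (q - 1)\<close>, which is below 1 because \<open>q < 1\<close>. The ceiling
  \<open>h\<close> removes the large values, where the weak bound alone would not be
  integrable.\<close>

lemma nn_integral_le_of_weak_bound:
  assumes f[measurable]: "f \<in> borel_measurable \<sigma>" and h: "0 < h" and q: "0 < q" "q < 1" and B: "0 \<le> B"
    and le: "\<And>x. x \<in> space \<sigma> \<Longrightarrow> f x \<le> ennreal h"
    and weak: "weak_L_norm \<sigma> q f \<le> ennreal B"
  shows "(\<integral>\<^sup>+x. f x \<partial>\<sigma>) \<le> ennreal (h * (2 / h) powr q / (1 - 2 powr (q - 1)) * B powr q)"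
proof -
  define A where "A = h * (2 * B / h) powr q"
  define \<rho> :: real where "\<rho> = 2 powr (q - 1)"
  have \<rho>: "0 < \<rho>" "\<rho> < 1"
    using q by (auto simp: \<rho>_def intro: powr_less_one)
  have A: "0 \<le> A"
    using h by (simp add: A_def)
  have "(\<integral>\<^sup>+x. f x \<partial>\<sigma>) \<le>
      (\<integral>\<^sup>+x. (\<Sum>k. ennreal (h / 2 ^ k) * indicator {ennreal (h / 2 ^ Suc k)<..} (f x)) \<partial>\<sigma>)"
    by (intro nn_integral_mono ennreal_le_dyadic_suminf h le)
  also have "\<dots> = (\<Sum>k. \<integral>\<^sup>+x. ennreal (h / 2 ^ k) * indicator {ennreal (h / 2 ^ Suc k)<..} (f x) \<partial>\<sigma>)"
    by (rule nn_integral_suminf) measurable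
  also have "\<dots> \<le> (\<Sum>k. ennreal (A * \<rho> ^ k))"
  proof (intro suminf_le allI)
    fix k
    define t where "t = h / 2 ^ Suc k"
    have t: "0 < t"
      using h by (simp add: t_def)
    have "(\<integral>\<^sup>+x. ennreal (h / 2 ^ k) * indicator {ennreal t<..} (f x) \<partial>\<sigma>) =
        (\<integral>\<^sup>+x. ennreal (h / 2 ^ k) * indicator {x \<in> space \<sigma>. ennreal t < f x} x \<partial>\<sigma>)"
      by (intro nn_integral_cong) (auto simp: indicator_def)
    also have "\<dots> = ennreal (h / 2 ^ k) * emeasure \<sigma> {x \<in> space \<sigma>. ennreal t < f x}"
      by (subst nn_integral_cmult_indicator) auto
    also have "\<dots> \<le> ennreal (h / 2 ^ k) * ennreal ((B / t) powr q)"
      using weak t by (intro mult_left_mono) (auto simp: weak_L_norm_le_iff[OF q(1) B])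
    also have "\<dots> = ennreal (h / 2 ^ k * (B / t) powr q)"
      using h by (intro ennreal_mult[symmetric]) auto
    also have "h / 2 ^ k * (B / t) powr q = A * \<rho> ^ k"
    proof -
      have "B / t = (2 * B / h) * 2 ^ k"
        using h by (simp add: t_def field_simps)
      then have "(B / t) powr q = (2 * B / h) powr q * (2 ^ k) powr q"
        using powr_mult[of "2 * B / h" "2 ^ k" q] h B by (simp only: \<open>B / t = _\<close>)
      moreover have "(2 ^ k) powr q = (2 powr q) ^ k" for k
        by (simp add: powr_powr mult.commute flip: powr_realpow)
      moreover have "\<rho> ^ k = (2 powr q) ^ k / 2 ^ k"
        by (simp add: \<rho>_def powr_diff power_divide)
      ultimately show ?thesis
        by (simp add: A_def)
    qed
    finally show "(\<integral>\<^sup>+x. ennreal (h / 2 ^ k) * indicator {ennreal (h / 2 ^ Suc k)<..} (f x) \<partial>\<sigma>)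
        \<le> ennreal (A * \<rho> ^ k)"
      by (simp add: t_def)
  qed auto
  also have "\<dots> = ennreal (\<Sum>k. A * \<rho> ^ k)"
    using \<rho> A by (intro suminf_ennreal2) (auto intro!: summable_mult summable_geometric)
  also have "(\<Sum>k. A * \<rho> ^ k) = A / (1 - \<rho>)"
    using \<rho> by (simp add: suminf_mult suminf_geometric summable_geometric)
  also have "A = h * (2 / h) powr q * B powr q"
    using powr_mult[of "2 / h" B q] h B by (simp add: A_def)
  finally show ?thesis
    by (simp add: \<rho>_def)
qed

section \<open>From weak bounds to the capacity inequality\<close>

context lsc_kernel
begin

text \<open>The common end of both routes to the capacity inequality. By \<open>half\<close>, the
  part of \<open>K\<close> below height \<open>t\<close> keeps mass at least \<open>s / 2\<close>,
  which is at most \<open>t\<close> times the capacity. The exponent \<open>1 - 1 / q\<close> is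
  such that dividing by the power of \<open>s / 2\<close> inside \<open>t\<close> leaves
  \<open>(s / 2) powr (1 / q)\<close>.\<close>

lemma sigma_le_capacity_powr:
  assumes \<sigma>: "\<sigma> \<in> loc_finite_measures \<Omega>" and K: "compact K" "K \<subseteq> \<Omega>"
    and q: "0 < q" and N: "0 < N" and s: "emeasure \<sigma> K = ennreal s" "0 < s"
    and t: "t = N * (s / 2) powr (1 - 1 / q)"
    and half: "emeasure \<sigma> {x \<in> K. ennreal t < potential G (density \<sigma> (indicator K)) x} \<le> ennreal (s / 2)"
  shows "emeasure \<sigma> K \<le> ennreal (2 * N powr q) * ennreal_powr (inner_capacity \<Omega> G K) q"
proof -
  note b = loc_finite_borel_on[OF \<sigma>]
  let ?P = "potential G (density \<sigma> (indicator K))"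
  let ?L = "{x \<in> K. ?P x \<le> ennreal t}" and ?U = "{x \<in> K. ennreal t < ?P x}"
  have t0: "0 < t"
    using N s t by simp
  have [measurable]: "?P \<in> borel_measurable \<sigma>"
    using b by (intro potential_measurable) auto
  have KE: "K = {x \<in> space \<sigma>. x \<in> K}"
    using K(2) space_borel_on[OF b] by auto
  have [measurable]: "K \<in> sets \<sigma>"
    using compact_in_sets[OF b K] .
  have "?L = {x \<in> space \<sigma>. x \<in> K \<and> ?P x \<le> ennreal t}" "?U = {x \<in> space \<sigma>. x \<in> K \<and> ennreal t < ?P x}"
    using K(2) space_borel_on[OF b] by auto
  then have "?L \<in> sets \<sigma>" "?U \<in> sets \<sigma>"
    by simp_all
  then have "emeasure \<sigma> (?L \<union> ?U) \<le> emeasure \<sigma> ?L + emeasure \<sigma> ?U"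
    by (rule emeasure_subadditive)
  also have "?L \<union> ?U = K"
    by auto
  also have "emeasure \<sigma> ?L + emeasure \<sigma> ?U \<le> ennreal t * inner_capacity \<Omega> G K + ennreal (s / 2)"
    by (intro add_mono sublevel_le_inner_capacity \<sigma> K t0 half)
  finally have le: "ennreal s \<le> ennreal t * inner_capacity \<Omega> G K + ennreal (s / 2)"
    by (simp add: s)
  show ?thesis
  proof (cases "inner_capacity \<Omega> G K")
    case (real k)
    have "s \<le> t * k + s / 2"
      using le real t0 s by (simp flip: ennreal_mult ennreal_plus)
    then have "s / 2 \<le> N * k * ((s / 2) powr (1 - 1 / q))"
      by (simp add: t mult_ac)
    then have "(s / 2) / (s / 2) powr (1 - 1 / q) \<le> N * k"
      using s by (simp add: pos_divide_le_eq)
    also have "(s / 2) / (s / 2) powr (1 - 1 / q) = (s / 2) powr (1 / q)"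
      using s powr_diff[of "s/2" 1 "1 - 1 / q"] by simp
    finally have "((s / 2) powr (1 / q)) powr q \<le> (N * k) powr q"
      using q by (intro powr_mono2) auto
    then have "s \<le> 2 * N powr q * k powr q"
      using q s N real by (simp add: powr_powr powr_mult)
    then show ?thesis
      using real by (simp add: s ennreal_powr_ennreal flip: ennreal_mult)
  next
    case top
    then show ?thesis
      using N by (simp add: ennreal_powr_def ennreal_mult_top)
  qed
qed


text \<open>The weak-type inequality is tested on the restriction of \<sigma> to \<open>K\<close>,
  whose mass is finite by compactness.\<close>

lemma capacity_of_weak_type:
  assumes \<sigma>: "\<sigma> \<in> loc_finite_measures \<Omega>" and q: "0 < q" and \<kappa>: "0 < \<kappa>"
    and weak: "\<And>\<nu>. \<nu> \<in> loc_finite_measures \<Omega> \<Longrightarrow>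
      weak_L_norm \<sigma> q (potential G \<nu>) \<le> ennreal \<kappa> * emeasure \<nu> \<Omega>"
    and K: "compact K" "K \<subseteq> \<Omega>"
  shows "emeasure \<sigma> K \<le> ennreal (2 * (2 * \<kappa>) powr q) * ennreal_powr (inner_capacity \<Omega> G K) q"
proof (cases "emeasure \<sigma> K = 0")
  case False
  note b = loc_finite_borel_on[OF \<sigma>]
  define \<sigma>K where "\<sigma>K = density \<sigma> (indicator K)"
  obtain s where s: "emeasure \<sigma> K = ennreal s" "0 < s"
    using False compact_finite_measure[OF \<sigma> K] by (cases "emeasure \<sigma> K") (auto simp: less_le)
  have [measurable]: "K \<in> sets \<sigma>"
    using compact_in_sets[OF b K] .
  have bK: "borel_on \<sigma>K"
    using b by (simp add: \<sigma>K_def)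
  have mass: "emeasure \<sigma>K \<Omega> = ennreal s"
    using s K(2) sets.top[of \<sigma>]
    by (simp add: \<sigma>K_def emeasure_density space_borel_on[OF b] nn_integral_indicator Int_absorb2 flip: indicator_inter_arith)
  then have "finite_measure \<sigma>K"
    by (intro finite_measureI) (simp add: space_borel_on[OF bK])
  then have "weak_L_norm \<sigma> q (potential G \<sigma>K) \<le> ennreal \<kappa> * ennreal s"
    using weak[of \<sigma>K] finite_loc_finite[OF bK] by (simp add: mass)
  then have w: "weak_L_norm \<sigma> q (potential G \<sigma>K) \<le> ennreal (\<kappa> * s)"
    using \<kappa> s by (simp add: ennreal_mult)
  \<comment> \<open>The height at which the weak-type bound for mass \<open>s\<close> equals exactly
    \<open>s / 2\<close>; the factor 2 comes from writing \<open>\<kappa> * s\<close> as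
    \<open>2 * \<kappa> * (s / 2)\<close>.\<close>
  define t where "t = 2 * \<kappa> * (s / 2) powr (1 - 1 / q)"
  have t0: "0 < t"
    using \<kappa> s by (simp add: t_def)
  have "\<kappa> * s / t = (s / 2) powr (1 / q)"
    using s \<kappa> by (simp add: t_def powr_diff)
  then have st: "(\<kappa> * s / t) powr q = s / 2"
    using q s by (simp add: powr_powr)
  have "emeasure \<sigma> {x \<in> K. ennreal t < potential G \<sigma>K x}
      \<le> emeasure \<sigma> {x \<in> space \<sigma>. ennreal t < potential G \<sigma>K x}"
    using K(2) by (intro emeasure_mono) (auto simp: space_borel_on[OF b]
        intro: open_in_sets[OF b open_potential_superlevel[OF bK]])
  also have "\<dots> \<le> ennreal ((\<kappa> * s / t) powr q)"
    using w weak_L_norm_le_iff[OF q, of "\<kappa> * s" \<sigma> "potential G \<sigma>K"] \<kappa> s t0 by simp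
  finally show ?thesis
    unfolding st \<sigma>K_def using \<kappa> by (intro sigma_le_capacity_powr[OF \<sigma> K q _ s t_def]) auto
qed simp

text \<open>The potential of the restriction of \<sigma> to \<open>K\<close> is dominated by that of
  \<sigma>, so the weak bound on the latter controls the superlevel set inside
  \<open>K\<close>.\<close>

lemma capacity_of_potential_weak_bound:
  assumes \<sigma>: "\<sigma> \<in> loc_finite_measures \<Omega>" and q: "0 < q" "q < 1" and N: "0 < N"
    and weak: "weak_L_norm \<sigma> (q / (1 - q)) (potential G \<sigma>) \<le> ennreal N"
    and K: "compact K" "K \<subseteq> \<Omega>"
  shows "emeasure \<sigma> K \<le> ennreal (2 * N powr q) * ennreal_powr (inner_capacity \<Omega> G K) q"
proof (cases "emeasure \<sigma> K = 0")
  case False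
  note b = loc_finite_borel_on[OF \<sigma>]
  define \<sigma>K where "\<sigma>K = density \<sigma> (indicator K)"
  obtain s where s: "emeasure \<sigma> K = ennreal s" "0 < s"
    using False compact_finite_measure[OF \<sigma> K] by (cases "emeasure \<sigma> K") (auto simp: less_le)
  have [measurable]: "K \<in> sets \<sigma>"
    using compact_in_sets[OF b K] .
  \<comment> \<open>Once more the weak bound at this height equals \<open>s / 2\<close>, since
    \<open>1 / q - 1\<close> and \<open>q / (1 - q)\<close> are reciprocal.\<close>
  define t where "t = N * (s / 2) powr (1 - 1 / q)"
  have t0: "0 < t"
    using N s by (simp add: t_def)
  have "N / t = (s / 2) powr (1 / q - 1)"
    using s N by (simp add: t_def powr_diff)
  moreover have "(1 / q - 1) * (q / (1 - q)) = 1"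
    using q by (simp add: field_simps)
  ultimately have st: "(N / t) powr (q / (1 - q)) = s / 2"
    using s by (simp only: powr_powr) simp
  have le: "potential G \<sigma>K x \<le> potential G \<sigma> x" if x: "x \<in> \<Omega>" for x
  proof -
    have "potential G \<sigma>K x = (\<integral>\<^sup>+y. indicator K y * G x y \<partial>\<sigma>)"
      unfolding potential_def \<sigma>K_def using kernel_section_measurable[OF b x]
      by (subst nn_integral_density) auto
    also have "\<dots> \<le> potential G \<sigma> x"
      unfolding potential_def by (intro nn_integral_mono) (auto simp: indicator_def)
    finally show ?thesis .
  qed
  have "emeasure \<sigma> {x \<in> K. ennreal t < potential G \<sigma>K x}
      \<le> emeasure \<sigma> {x \<in> space \<sigma>. ennreal t < potential G \<sigma> x}"
    using K(2) le by (intro emeasure_mono) (auto simp: space_borel_on[OF b]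
        intro: less_le_trans open_in_sets[OF b open_potential_superlevel[OF b]])
  also have "\<dots> \<le> ennreal ((N / t) powr (q / (1 - q)))"
    using weak weak_L_norm_le_iff[of "q / (1 - q)" N \<sigma> "potential G \<sigma>"] q N t0 by simp
  finally show ?thesis
    unfolding st \<sigma>K_def by (intro sigma_le_capacity_powr[OF \<sigma> K q(1) N s t_def])
qed simp

end

section \<open>Duality, the maximum principle, and weak bounds from capacity\<close>

locale wmp_kernel = lsc_kernel +
  fixes a h :: real
  assumes a: "0 < a" and h: "1 \<le> h"
    and qs: "\<And>x y. x \<in> \<Omega> \<Longrightarrow> y \<in> \<Omega> \<Longrightarrow> G x y \<le> ennreal a * G y x"
    and wmp: "\<And>\<nu> M x. \<nu> \<in> loc_finite_measures \<Omega> \<Longrightarrow> 0 < M \<Longrightarrow>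
      (\<And>z. z \<in> measure_support \<nu> \<Longrightarrow> potential G \<nu> z \<le> ennreal M) \<Longrightarrow>
      x \<in> \<Omega> \<Longrightarrow> potential G \<nu> x \<le> ennreal (h * M)"
begin

text \<open>After Tonelli the inner integral runs over the first argument of \<open>G\<close>;
  quasi-symmetry turns it back into a potential at the price of the factor \<open>a\<close>.\<close>

lemma potential_duality:
  assumes \<mu>: "\<mu> \<in> loc_finite_measures \<Omega>" and \<nu>: "\<nu> \<in> loc_finite_measures \<Omega>"
  shows "(\<integral>\<^sup>+x. potential G \<nu> x \<partial>\<mu>) \<le> ennreal a * (\<integral>\<^sup>+y. potential G \<mu> y \<partial>\<nu>)"
proof -
  note b\<mu> = loc_finite_borel_on[OF \<mu>] and b\<nu> = loc_finite_borel_on[OF \<nu>]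
  interpret \<mu>: sigma_finite_measure \<mu> by (rule loc_finite_sigma_finite[OF \<mu>])
  interpret \<nu>: sigma_finite_measure \<nu> by (rule loc_finite_sigma_finite[OF \<nu>])
  interpret pair_sigma_finite \<mu> \<nu> ..
  have "(\<integral>\<^sup>+x. potential G \<nu> x \<partial>\<mu>) = (\<integral>\<^sup>+y. (\<integral>\<^sup>+x. G x y \<partial>\<mu>) \<partial>\<nu>)"
    unfolding potential_def using Fubini'[OF kernel_measurable[OF b\<mu> b\<nu>]] by simp
  also have "\<dots> \<le> (\<integral>\<^sup>+y. (\<integral>\<^sup>+x. ennreal a * G y x \<partial>\<mu>) \<partial>\<nu>)"
    by (intro nn_integral_mono qs) (auto simp: space_borel_on b\<mu> b\<nu>)
  also have "\<dots> = (\<integral>\<^sup>+y. ennreal a * potential G \<mu> y \<partial>\<nu>)"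
    unfolding potential_def
    by (intro nn_integral_cong nn_integral_cmult kernel_section_measurable[OF b\<mu>])
      (simp add: space_borel_on[OF b\<nu>])
  also have "\<dots> = ennreal a * (\<integral>\<^sup>+y. potential G \<mu> y \<partial>\<nu>)"
    by (intro nn_integral_cmult potential_measurable b\<mu> b\<nu>)
  finally show ?thesis .
qed

text \<open>Restricting \<open>\<mu>\<close> to \<open>K\<close> avoids having to show that a
  measure is carried by its support: \<open>\<eta>\<close> lives where \<open>ge\<close> applies.
  The maximum principle is applied to \<open>\<mu>\<close> itself with \<open>M = 1\<close>, and the
  smaller measure \<open>\<eta>\<close> inherits the bound \<open>h\<close>.\<close>

lemma admissible_measure_bound:
  assumes \<mu>: "borel_on \<mu>" "finite_measure \<mu>" "\<And>x. x \<in> measure_support \<mu> \<Longrightarrow> potential G \<mu> x \<le> 1"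
    and K: "compact K" "K \<subseteq> \<Omega>" and \<nu>: "\<nu> \<in> loc_finite_measures \<Omega>"
    and ge: "\<And>x. x \<in> K \<Longrightarrow> ennreal t \<le> potential G \<nu> x"
  obtains \<eta> where "\<eta> \<in> loc_finite_measures \<Omega>" "emeasure \<eta> \<Omega> = emeasure \<mu> K"
    "\<And>x. x \<in> \<Omega> \<Longrightarrow> potential G \<eta> x \<le> ennreal h"
    "ennreal t * emeasure \<mu> K \<le> ennreal a * (\<integral>\<^sup>+x. potential G \<eta> x \<partial>\<nu>)"
proof -
  note b\<nu> = loc_finite_borel_on[OF \<nu>]
  define \<eta> where "\<eta> = density \<mu> (indicator K)"
  have [measurable]: "K \<in> sets \<mu>"
    using compact_in_sets[OF \<mu>(1) K] .
  have b: "borel_on \<eta>"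
    using \<mu>(1) by (simp add: \<eta>_def)
  have mass: "emeasure \<eta> \<Omega> = emeasure \<mu> K"
    using K(2) sets.top[of \<mu>]
    by (simp add: \<eta>_def emeasure_density space_borel_on[OF \<mu>(1)] nn_integral_indicator Int_absorb2 flip: indicator_inter_arith)
  then have "finite_measure \<eta>"
    using finite_measure.emeasure_finite[OF \<mu>(2)]
    by (intro finite_measureI) (simp add: space_borel_on[OF b])
  then have lf: "\<eta> \<in> loc_finite_measures \<Omega>"
    by (rule finite_loc_finite[OF b])
  have pot: "potential G \<eta> x \<le> ennreal h" if x: "x \<in> \<Omega>" for x
  proof -
    have "potential G \<eta> x = (\<integral>\<^sup>+y. indicator K y * G x y \<partial>\<mu>)"
      unfolding potential_def \<eta>_def using kernel_section_measurable[OF \<mu>(1) x]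
      by (subst nn_integral_density) auto
    also have "\<dots> \<le> potential G \<mu> x"
      unfolding potential_def by (intro nn_integral_mono) (auto simp: indicator_def)
    also have "\<dots> \<le> ennreal h"
      using wmp[OF finite_loc_finite[OF \<mu>(1,2)], of 1 x] \<mu>(3) x by simp
    finally show ?thesis .
  qed
  have "ennreal t * emeasure \<mu> K = (\<integral>\<^sup>+x. ennreal t * indicator K x \<partial>\<mu>)"
    by (simp add: nn_integral_cmult)
  also have "\<dots> \<le> (\<integral>\<^sup>+x. indicator K x * potential G \<nu> x \<partial>\<mu>)"
    using ge by (intro nn_integral_mono) (auto simp: indicator_def)
  also have "\<dots> = (\<integral>\<^sup>+x. potential G \<nu> x \<partial>\<eta>)"
    unfolding \<eta>_def using potential_measurable[OF b\<nu> \<mu>(1)]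
    by (subst nn_integral_density) auto
  also have "\<dots> \<le> ennreal a * (\<integral>\<^sup>+x. potential G \<eta> x \<partial>\<nu>)"
    by (rule potential_duality[OF lf \<nu>])
  finally show ?thesis
    using that lf mass pot by blast
qed

text \<open>A Chebyshev inequality for capacity: the dual potential is at most \<open>h\<close>, so
  its integral against \<open>\<nu>\<close> is at most \<open>h * m\<close>.\<close>

lemma inner_capacity_le_mass:
  assumes K: "compact K" "K \<subseteq> \<Omega>" and \<nu>: "\<nu> \<in> loc_finite_measures \<Omega>"
    and ge: "\<And>x. x \<in> K \<Longrightarrow> ennreal t \<le> potential G \<nu> x"
    and t: "0 < t" and m: "emeasure \<nu> \<Omega> = ennreal m" "0 \<le> m"
  shows "inner_capacity \<Omega> G K \<le> ennreal (a * h * m / t)"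
  unfolding inner_capacity_def
proof (intro SUP_least, elim CollectE conjE)
  fix \<mu> assume \<mu>: "borel_on \<mu>" "finite_measure \<mu>" "\<forall>x\<in>measure_support \<mu>. potential G \<mu> x \<le> 1"
  obtain \<eta> where \<eta>: "\<And>x. x \<in> \<Omega> \<Longrightarrow> potential G \<eta> x \<le> ennreal h"
    "ennreal t * emeasure \<mu> K \<le> ennreal a * (\<integral>\<^sup>+x. potential G \<eta> x \<partial>\<nu>)"
    using admissible_measure_bound[OF \<mu>(1,2) _ K \<nu> ge] \<mu>(3) by blast
  note \<eta>(2)
  also have "ennreal a * (\<integral>\<^sup>+x. potential G \<eta> x \<partial>\<nu>) \<le> ennreal a * (\<integral>\<^sup>+x. ennreal h \<partial>\<nu>)"
    using \<eta>(1) space_borel_on[OF loc_finite_borel_on[OF \<nu>]] by (intro mult_left_mono nn_integral_mono) auto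
  also have "\<dots> = ennreal (a * h * m)"
    using a h m space_borel_on[OF loc_finite_borel_on[OF \<nu>]] by (simp add: ennreal_mult mult.assoc)
  finally have *: "ennreal t * emeasure \<mu> K \<le> ennreal (a * h * m)" .
  obtain k where "emeasure \<mu> K = ennreal k" "0 \<le> k"
    using finite_measure.emeasure_finite[OF \<mu>(2), of K] by (cases "emeasure \<mu> K") auto
  with * show "emeasure \<mu> K \<le> ennreal (a * h * m / t)"
    using t a h m by (simp add: field_simps flip: ennreal_mult)
qed

text \<open>\<open>inner_capacity_le_mass\<close> bounds the capacity of every compact subset of a
  superlevel set; \<open>cap\<close> converts this into a bound on its \<sigma>-measure, and
  exhaustion covers the whole superlevel set.\<close>

lemma weak_type_of_capacity:
  assumes \<sigma>: "\<sigma> \<in> loc_finite_measures \<Omega>" and q: "0 < q" and c: "0 < c"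
    and cap: "\<And>K. compact K \<Longrightarrow> K \<subseteq> \<Omega> \<Longrightarrow>
      emeasure \<sigma> K \<le> ennreal c * ennreal_powr (inner_capacity \<Omega> G K) q"
    and \<nu>: "\<nu> \<in> loc_finite_measures \<Omega>"
  shows "weak_L_norm \<sigma> q (potential G \<nu>) \<le> ennreal (c powr (1 / q) * a * h) * emeasure \<nu> \<Omega>"
proof (cases "emeasure \<nu> \<Omega>")
  case (real m)
  note b = loc_finite_borel_on[OF \<sigma>] and b\<nu> = loc_finite_borel_on[OF \<nu>]
  \<comment> \<open>The power \<open>c powr (1 / q)\<close> becomes the factor \<open>c\<close> of
    the capacity inequality when \<open>B / t\<close> is raised to the power
    \<open>q\<close>.\<close>
  define B where "B = c powr (1 / q) * a * h * m"
  have B: "0 \<le> B"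
    using a h real by (simp add: B_def)
  have "emeasure \<sigma> {x \<in> space \<sigma>. ennreal t < potential G \<nu> x} \<le> ennreal ((B / t) powr q)" if t: "0 < t" for t
    unfolding space_borel_on[OF b]
  proof (rule emeasure_open_le[OF b open_potential_superlevel[OF b\<nu>]])
    fix K assume K: "compact K" "K \<subseteq> {x \<in> \<Omega>. ennreal t < potential G \<nu> x}"
    have nonneg: "0 \<le> a * h * m / t"
      using a h real t by simp
    have "inner_capacity \<Omega> G K \<le> ennreal (a * h * m / t)"
      using K real t by (intro inner_capacity_le_mass[OF _ _ \<nu>]) (auto simp: subset_iff)
    then have "ennreal_powr (inner_capacity \<Omega> G K) q \<le> ennreal ((a * h * m / t) powr q)"
      using ennreal_powr_mono[of q] q nonneg by (metis ennreal_powr_ennreal less_imp_le)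
    then have "ennreal c * ennreal_powr (inner_capacity \<Omega> G K) q \<le> ennreal c * ennreal ((a * h * m / t) powr q)"
      by (rule mult_left_mono) simp
    also have "\<dots> = ennreal ((B / t) powr q)"
    proof -
      have "B / t = c powr (1 / q) * (a * h * m / t)"
        by (simp add: B_def)
      then have "(B / t) powr q = c * (a * h * m / t) powr q"
        using powr_mult[of "c powr (1 / q)" "a * h * m / t" q] nonneg c q by (simp only: \<open>B / t = _\<close> powr_powr) simp
      then show ?thesis
        using c by (simp add: ennreal_mult)
    qed
    finally show "emeasure \<sigma> K \<le> ennreal ((B / t) powr q)"
      using cap[of K] K by (auto intro: order_trans)
  qed auto
  then have "weak_L_norm \<sigma> q (potential G \<nu>) \<le> ennreal B"
    by (simp add: weak_L_norm_le_iff[OF q B])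
  then show ?thesis
    using real a h c by (simp add: B_def ennreal_mult mult.assoc)
next
  \<comment> \<open>The constant is positive, so for infinite mass the right-hand side is
    infinite.\<close>
  case top
  then show ?thesis
    using a h c by (auto simp: ennreal_mult_top)
qed

text \<open>A self-improving estimate. Duality against \<sigma> itself bounds \<open>t * m\<close>,
  with \<open>m\<close> the mass on \<open>K\<close> of an admissible measure, by
  \<open>D * m powr q\<close>. As \<open>m\<close> is finite and \<open>q < 1\<close>, the power is
  absorbed on the left and bounds the capacity; the exponent \<open>q\<close> in \<open>cap\<close>
  then produces \<open>q / (1 - q)\<close>.\<close>

lemma potential_weak_bound:
  assumes \<sigma>: "\<sigma> \<in> loc_finite_measures \<Omega>" and q: "0 < q" "q < 1" and c: "0 < c" and \<kappa>: "0 < \<kappa>"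
    and cap: "\<And>K. compact K \<Longrightarrow> K \<subseteq> \<Omega> \<Longrightarrow>
      emeasure \<sigma> K \<le> ennreal c * ennreal_powr (inner_capacity \<Omega> G K) q"
    and weak: "\<And>\<nu>. \<nu> \<in> loc_finite_measures \<Omega> \<Longrightarrow>
      weak_L_norm \<sigma> q (potential G \<nu>) \<le> ennreal \<kappa> * emeasure \<nu> \<Omega>"
  shows "weak_L_norm \<sigma> (q / (1 - q)) (potential G \<sigma>) < \<infinity>"
proof -
  note b = loc_finite_borel_on[OF \<sigma>]
  \<comment> \<open>\<open>C\<close> is the constant of \<open>nn_integral_le_of_weak_bound\<close>
    with the ceiling \<open>h\<close> from the maximum principle. \<open>D\<close> adds the factor
    \<open>a\<close> of duality and the power of \<open>\<kappa>\<close> from the weak-type bound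
    for \<open>\<eta>\<close>.\<close>
  define C where "C = h * (2 / h) powr q / (1 - 2 powr (q - 1))"
  define D where "D = a * C * \<kappa> powr q"
  define r where "r = q / (1 - q)"
  define B where "B = c powr (1 / r) * D"
  have r: "0 < r"
    using q by (simp add: r_def)
  have "(2::real) powr (q - 1) < 1"
    using q by (intro powr_less_one) auto
  then have C: "0 < C"
    using h by (simp add: C_def)
  then have D: "0 < D"
    using a \<kappa> by (simp add: D_def)
  have B: "0 \<le> B"
    using D by (simp add: B_def)
  have capb: "inner_capacity \<Omega> G K \<le> ennreal ((D / t) powr (1 / (1 - q)))"
    if K: "compact K" "K \<subseteq> {x \<in> \<Omega>. ennreal t < potential G \<sigma> x}" and t: "0 < t" for K t
    unfolding inner_capacity_def
  proof (intro SUP_least, elim CollectE conjE)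
    fix \<mu> assume \<mu>: "borel_on \<mu>" "finite_measure \<mu>" "\<forall>x\<in>measure_support \<mu>. potential G \<mu> x \<le> 1"
    obtain \<eta> where \<eta>: "\<eta> \<in> loc_finite_measures \<Omega>" "emeasure \<eta> \<Omega> = emeasure \<mu> K"
      "\<And>x. x \<in> \<Omega> \<Longrightarrow> potential G \<eta> x \<le> ennreal h"
      "ennreal t * emeasure \<mu> K \<le> ennreal a * (\<integral>\<^sup>+x. potential G \<eta> x \<partial>\<sigma>)"
      by (rule admissible_measure_bound[OF \<mu>(1,2) _ K(1) _ \<sigma>, of t]) (use \<mu>(3) K(2) in \<open>auto simp: subset_iff\<close>)
    obtain m where m: "emeasure \<mu> K = ennreal m" "0 \<le> m"
      using finite_measure.emeasure_finite[OF \<mu>(2), of K] by (cases "emeasure \<mu> K") auto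
    have "weak_L_norm \<sigma> q (potential G \<eta>) \<le> ennreal (\<kappa> * m)"
      using weak[OF \<eta>(1)] \<kappa> m by (simp add: \<eta>(2) ennreal_mult)
    then have "(\<integral>\<^sup>+x. potential G \<eta> x \<partial>\<sigma>) \<le> ennreal (C * (\<kappa> * m) powr q)"
      unfolding C_def using h q \<kappa> m \<eta>(3) space_borel_on[OF b]
      by (intro nn_integral_le_of_weak_bound potential_measurable[OF loc_finite_borel_on[OF \<eta>(1)] b]) auto
    then have "ennreal a * (\<integral>\<^sup>+x. potential G \<eta> x \<partial>\<sigma>) \<le> ennreal a * ennreal (C * (\<kappa> * m) powr q)"
      by (rule mult_left_mono) simp
    also have "\<dots> = ennreal (D * m powr q)"
      using a C \<kappa> m by (simp add: D_def powr_mult mult.assoc flip: ennreal_mult)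
    finally have "ennreal (t * m) \<le> ennreal (D * m powr q)"
      using \<eta>(4) m t by (auto simp: ennreal_mult)
    then have tm: "t * m \<le> D * m powr q"
      using D by (simp add: ennreal_le_iff)
    have "m \<le> (D / t) powr (1 / (1 - q))"
    \<comment> \<open>Absorbing the power means dividing by \<open>m powr q\<close>.\<close>
    proof (cases "m = 0")
      case False
      then have "m powr (1 - q) \<le> D / t"
        using tm m t by (simp add: powr_diff field_simps)
      then have "(m powr (1 - q)) powr (1 / (1 - q)) \<le> (D / t) powr (1 / (1 - q))"
        using q by (intro powr_mono2) auto
      then show ?thesis
        using q m by (simp add: powr_powr)
    qed simp
    then show "emeasure \<mu> K \<le> ennreal ((D / t) powr (1 / (1 - q)))"
      by (simp add: m ennreal_leI)
  qed
  have "emeasure \<sigma> {x \<in> space \<sigma>. ennreal t < potential G \<sigma> x} \<le> ennreal ((B / t) powr r)" if t: "0 < t" for t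
    unfolding space_borel_on[OF b]
  proof (rule emeasure_open_le[OF b open_potential_superlevel[OF b]])
    fix K assume K: "compact K" "K \<subseteq> {x \<in> \<Omega>. ennreal t < potential G \<sigma> x}"
    have "ennreal_powr (inner_capacity \<Omega> G K) q \<le> ennreal_powr (ennreal ((D / t) powr (1 / (1 - q)))) q"
      using q by (intro ennreal_powr_mono capb K t) auto
    also have "\<dots> = ennreal ((D / t) powr r)"
      by (simp add: ennreal_powr_ennreal powr_powr r_def)
    finally have "ennreal c * ennreal_powr (inner_capacity \<Omega> G K) q \<le> ennreal c * ennreal ((D / t) powr r)"
      by (rule mult_left_mono) simp
    also have "\<dots> = ennreal ((B / t) powr r)"
    proof -
      have "B / t = c powr (1 / r) * (D / t)"
        by (simp add: B_def)
      then have "(B / t) powr r = c * (D / t) powr r"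
        using powr_mult[of "c powr (1 / r)" "D / t" r] D t c r by (simp only: \<open>B / t = _\<close> powr_powr) simp
      then show ?thesis
        using c by (simp add: ennreal_mult)
    qed
    finally show "emeasure \<sigma> K \<le> ennreal ((B / t) powr r)"
      using cap[of K] K by (auto intro: order_trans)
  qed auto
  then have "weak_L_norm \<sigma> r (potential G \<sigma>) \<le> ennreal B"
    by (simp add: weak_L_norm_le_iff[OF r B])
  then show ?thesis
    unfolding r_def by (simp add: le_less_trans)
qed

end

section \<open>Assembling the equivalences\<close>

theorem theorem2p10:
  fixes \<Omega> :: "(real ^ 'n) set"
    and \<sigma> :: "(real ^ 'n) measure"
    and q :: real
    and G :: "real ^ 'n \<Rightarrow> real ^ 'n \<Rightarrow> ennreal"
  assumes "open \<Omega>" and "connected \<Omega>"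
    and "\<sigma> \<in> loc_finite_measures \<Omega>"
    and "0 < q" and "q < 1"
    and "lower_semicontinuous_on (\<Omega> \<times> \<Omega>) (\<lambda>(x, y). G x y)"
    and "quasi_symmetric \<Omega> G"
    and "weak_maximum_principle \<Omega> G"
  shows "((\<exists>\<kappa>::real. \<kappa> > 0 \<and> (\<forall>\<nu>\<in>loc_finite_measures \<Omega>.
              weak_L_norm \<sigma> q (potential G \<nu>) \<le> ennreal \<kappa> * emeasure \<nu> \<Omega>))
          \<longleftrightarrow>
          (\<exists>c::real. c > 0 \<and> (\<forall>K. compact K \<and> K \<subseteq> \<Omega> \<longrightarrow>
              emeasure \<sigma> K \<le> ennreal c * ennreal_powr (inner_capacity \<Omega> G K) q)))
       \<and> ((\<exists>c::real. c > 0 \<and> (\<forall>K. compact K \<and> K \<subseteq> \<Omega> \<longrightarrow>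
              emeasure \<sigma> K \<le> ennreal c * ennreal_powr (inner_capacity \<Omega> G K) q))
          \<longleftrightarrow>
          potential G \<sigma> \<in> weak_L_space \<sigma> (q / (1 - q)))"
    (is "(?weak \<longleftrightarrow> ?cap) \<and> (_ \<longleftrightarrow> ?pot)")
proof -
  note \<sigma> = assms(3) and q = assms(4,5)
  obtain a where a: "0 < a" "\<And>x y. x \<in> \<Omega> \<Longrightarrow> y \<in> \<Omega> \<Longrightarrow> G x y \<le> ennreal a * G y x"
    using assms(7) unfolding quasi_symmetric_def by blast
  obtain h where h: "1 \<le> h" and wmp: "\<forall>\<nu>\<in>loc_finite_measures \<Omega>. \<forall>M>0.
      (\<forall>x\<in>measure_support \<nu>. potential G \<nu> x \<le> ennreal M) \<longrightarrow>
      (\<forall>x\<in>\<Omega>. potential G \<nu> x \<le> ennreal (h * M))"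
    using assms(8) unfolding weak_maximum_principle_def by (elim exE conjE)
  interpret wmp_kernel \<Omega> G a h
  proof unfold_locales
    show "potential G \<nu> x \<le> ennreal (h * M)"
      if "\<nu> \<in> loc_finite_measures \<Omega>" "0 < M"
        "\<And>z. z \<in> measure_support \<nu> \<Longrightarrow> potential G \<nu> z \<le> ennreal M" "x \<in> \<Omega>" for \<nu> M x
      using wmp that by blast
    show "G x y \<le> ennreal a * G y x" if "x \<in> \<Omega>" "y \<in> \<Omega>" for x y
      by (rule a(2)[OF that])
  qed (rule assms(1,6) a(1) h)+
  have weak_cap: ?cap if ?weak
  proof -
    from that obtain \<kappa> where \<kappa>: "\<kappa> > 0" "\<forall>\<nu>\<in>loc_finite_measures \<Omega>.
        weak_L_norm \<sigma> q (potential G \<nu>) \<le> ennreal \<kappa> * emeasure \<nu> \<Omega>"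
      by (elim exE conjE)
    note \<kappa> = \<kappa>(1) \<kappa>(2)[rule_format]
    show ?cap
      using \<kappa>(1) by (intro exI[of _ "2 * (2 * \<kappa>) powr q"] conjI allI impI capacity_of_weak_type[OF \<sigma> q(1) \<kappa>]) auto
  qed
  have cap_weak: ?weak if ?cap
  proof -
    from that obtain c where c: "c > 0" "\<forall>K. compact K \<and> K \<subseteq> \<Omega> \<longrightarrow>
        emeasure \<sigma> K \<le> ennreal c * ennreal_powr (inner_capacity \<Omega> G K) q"
      by (elim exE conjE)
    note c = c(1) c(2)[rule_format, OF conjI]
    show ?weak
      using c(1) a(1) h
      by (intro exI[of _ "c powr (1 / q) * a * h"] conjI ballI weak_type_of_capacity[OF \<sigma> q(1) c]) auto
  qed
  have cap_pot: ?pot if cap: ?cap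
  proof -
    from cap obtain c where c: "c > 0" "\<forall>K. compact K \<and> K \<subseteq> \<Omega> \<longrightarrow>
        emeasure \<sigma> K \<le> ennreal c * ennreal_powr (inner_capacity \<Omega> G K) q"
      by (elim exE conjE)
    note c = c(1) c(2)[rule_format, OF conjI]
    \<comment> \<open>The bound on the potential of \<sigma> uses the weak-type inequality too,
      applied to restrictions of admissible measures, so it is first derived from the capacity
      inequality.\<close>
    from cap_weak[OF cap] obtain \<kappa> where \<kappa>: "\<kappa> > 0" "\<forall>\<nu>\<in>loc_finite_measures \<Omega>.
        weak_L_norm \<sigma> q (potential G \<nu>) \<le> ennreal \<kappa> * emeasure \<nu> \<Omega>"
      by (elim exE conjE)
    note \<kappa> = \<kappa>(1) \<kappa>(2)[rule_format]
    have "weak_L_norm \<sigma> (q / (1 - q)) (potential G \<sigma>) < \<infinity>"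
      by (rule potential_weak_bound[OF \<sigma> q c(1) \<kappa>(1) c(2) \<kappa>(2)])
    then show ?pot
      using potential_measurable[of \<sigma> \<sigma>] loc_finite_borel_on[OF \<sigma>] by (simp add: weak_L_space_def)
  qed
  have pot_cap: ?cap if ?pot
  proof -
    from that obtain N where N: "weak_L_norm \<sigma> (q / (1 - q)) (potential G \<sigma>) = ennreal N" "0 \<le> N"
      by (cases "weak_L_norm \<sigma> (q / (1 - q)) (potential G \<sigma>)") (auto simp: weak_L_space_def)
    \<comment> \<open>The weak norm may vanish, while the constant of the capacity inequality has to
      be positive; hence \<open>N + 1\<close>.\<close>
    then have "weak_L_norm \<sigma> (q / (1 - q)) (potential G \<sigma>) \<le> ennreal (N + 1)"
      by (simp add: ennreal_leI)
    then show ?cap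
      using N(2) by (intro exI[of _ "2 * (N + 1) powr q"] conjI allI impI
          capacity_of_potential_weak_bound[OF \<sigma> q]) auto
  qed
  show ?thesis
    using weak_cap cap_weak cap_pot pot_cap by blast
qed

end
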